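(* The matrices $T_{-\varkappa}\left(c_{-n-\varkappa}^{\,n-\varkappa}\right)$ are invertible for all $n\ge n_0$. Moreover, let $n\ge n_0+1$ and denote by $\alpha=(\alpha_1,\ldots,\alpha_n)^T$ and $\beta=(\beta_0,\ldots,\beta_n)^T$ the solutions of the systems $$T_{-\varkappa}\left(c_{-n-\varkappa+1}^{\,n-\varkappa-1}\right)\alpha=-(c_{-n-\varkappa},c_{-n-\varkappa+1},\ldots,c_{-\varkappa-1})^T,\qquad T_{-\varkappa}\left(c_{-n-\varkappa}^{\,n-\varkappa}\right)\beta=e_1,$$ where $e_1=(1,0,\ldots,0)^T$. Then $\alpha_1=\cdots=\alpha_{n-\varkappa}=0$, $\beta_0\neq 0$, $\beta_{\nu-\varkappa+1}=\cdots=\beta_n=0$, and the factors of the Wiener--Hopf factorization $p(z)=p_-(z)z^{\varkappa}p_+(z)$ normalized by $p_-(\infty)=1$ are given by $$p_-(z)=z^{-\varkappa}\left(\alpha_{n-\varkappa+1}+\cdots+\alpha_nz^{\varkappa-1}+z^{\varkappa}\right),\qquad p_+(z)=\beta_0+\beta_1z+\cdots+\beta_{\nu-\varkappa}z^{\nu-\varkappa}.$$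
   Context: Let $p(z)$ be a complex polynomial of degree $\nu>1$ with $p(0)\ne0$ and with no zeros on the closed annulus $K=\{z\in\mathbb C: r\le|z|\le R\}$, where $0<r<1<R<\infty$. Let $\varkappa$ be the number of zeros of $p$ (with multiplicity) inside the unit circle; assume $0<\varkappa<\nu$, and put $n_0=\max\{\varkappa,\nu-\varkappa\}$. Write $p(z)=p_1(z)p_2(z)$ where $p_1$ is monic of degree $\varkappa$ with all zeros in $\{|z|<r\}$ and $p_2$ has degree $\nu-\varkappa$ with all zeros in $\{|z|>R\}$. The Wiener--Hopf factorization of $p$ normalized by $p_-(\infty)=1$ is $p(z)=p_-(z)z^\varkappa p_+(z)$, $|z|=1$, with $p_-(z)=z^{-\varkappa}p_1(z)$ and $p_+(z)=p_2(z)$. Let $c_k$, $k\in\mathbb Z$, be the Laurent coefficients of $1/p(z)=\sum_{k=-\infty}^{\infty}c_kz^k$ in $K$. For integers $M<N$ denote $c_M^{\,N}=(c_M,c_{M+1},\ldots,c_N)$ and, for $M\le k\le N$, let $T_k(c_M^{\,N})$ be the $(N-k+1)\times(k-M+1)$ Toeplitz matrix whose $(i,j)$ entry ($0\le i\le N-k$, $0\le j\le k-M$) is $c_{k+i-j}$; thus its first row is $(c_k,c_{k-1},\ldots,c_M)$ and its first column is $(c_k,c_{k+1},\ldots,c_N)^T$. *)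

theory Defs
  imports
    "HOL-Complex_Analysis.Complex_Analysis"
    "Jordan_Normal_Form.Matrix"
begin

text \<open>
  The Toeplitz matrix \<open>T\<^sub>k(c\<^sub>M, \<dots>, c\<^sub>N)\<close> for \<open>M \<le> k \<le> N\<close>.  Both the sequence \<open>c\<close> and
  the subscript \<open>k\<close> are indexed by the integers; only \<open>c\<^sub>M, \<dots>, c\<^sub>N\<close> occur in the matrix.
\<close>

definition toeplitz_mat :: "int \<Rightarrow> (int \<Rightarrow> 'a) \<Rightarrow> int \<Rightarrow> int \<Rightarrow> 'a mat" where
  "toeplitz_mat k c M N =
     Matrix.mat (nat (N - k + 1)) (nat (k - M + 1)) (\<lambda>(i, j). c (k + int i - int j))"

text \<open>
  Two-sided Laurent expansion on a set of nonzero points.  The sum is unconditional, which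
  for Laurent series on an annulus with interior agrees with separate convergence of
  the two one-sided series in the interior; the coefficients are uniquely determined there.
\<close>

definition laurent_expansion_on :: "(complex \<Rightarrow> complex) \<Rightarrow> (int \<Rightarrow> complex) \<Rightarrow> complex set \<Rightarrow> bool" where
  "laurent_expansion_on f c K \<longleftrightarrow> (\<forall>z\<in>K. ((\<lambda>k. c k * z powi k) has_sum f z) UNIV)"

text \<open>
  Scalar Wiener--Hopf factorization \<open>f(z) = f\<^sub>-(z) z\<^sup>k f\<^sub>+(z)\<close> on the unit circle, normalized by
  \<open>f\<^sub>-(\<infinity>) = 1\<close>.  The limit also expresses that \<open>f\<^sub>-\<close> is analytic and nonzero at infinity.
\<close>

definition wiener_hopf_factorization ::
    "(complex \<Rightarrow> complex) \<Rightarrow> int \<Rightarrow> (complex \<Rightarrow> complex) \<Rightarrow> (complex \<Rightarrow> complex) \<Rightarrow> bool" where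
  "wiener_hopf_factorization f k fm fp \<longleftrightarrow>
     fm holomorphic_on {z. norm z > 1} \<and> continuous_on {z. norm z \<ge> 1} fm \<and>
     (\<forall>z. norm z \<ge> 1 \<longrightarrow> fm z \<noteq> 0) \<and> (fm \<longlongrightarrow> 1) at_infinity \<and>
     fp holomorphic_on {z. norm z < 1} \<and> continuous_on {z. norm z \<le> 1} fp \<and>
     (\<forall>z. norm z \<le> 1 \<longrightarrow> fp z \<noteq> 0) \<and>
     (\<forall>z. norm z = 1 \<longrightarrow> f z = fm z * z powi k * fp z)"

end

(* Polynomials act on two-sided sequences by convolution, and 1/p = sum c_k z^k on the unit circle
   says that p * c is the unit sequence.  The sequence c is bounded, and a bounded
   sequence annihilated by p_1 (zeros inside the circle) on a right half-line vanishes there up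
   to a shift, and likewise for p_2 (zeros outside) on a left half-line.  If b has degree at most n
   and b * c vanishes on the n + 1 consecutive indices -kappa, ..., n - kappa, split b * c into its
   parts to the right and to the left of this gap.  The two half-line statements show that p kills
   both parts, so b = p * (b * c) = 0.  This is the invertibility of the Toeplitz matrices.
   By uniqueness it remains to see that z^(n - kappa) p_1 and p_2 solve the two systems:
   the half-line statements show that p_1 * c vanishes on negative indices, and that p_2 * c is
   1 at -kappa and vanishes to the right of it. *)

theory Submission
  imports Defs "HOL-Computational_Algebra.Fundamental_Theorem_Algebra" "Jordan_Normal_Form.Determinant"
begin

section \<open>The action of polynomials on two-sided sequences\<close>

text \<open>In operator terms this is \<open>p\<close> evaluated at the shift taking
  \<open>c\<close> to \<open>\<lambda>k. c (k - 1)\<close>. Products of polynomials therefore become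
  compositions, and any two such operators commute.\<close>

definition poly_act :: "'a::comm_ring_1 poly \<Rightarrow> (int \<Rightarrow> 'a) \<Rightarrow> int \<Rightarrow> 'a" where
  "poly_act p c k = (\<Sum>j\<le>degree p. coeff p j * c (k - int j))"

lemma poly_act_eq_sum:
  assumes "degree p \<le> N"
  shows "poly_act p c k = (\<Sum>j\<le>N. coeff p j * c (k - int j))"
  unfolding poly_act_def
  by (rule sum.mono_neutral_left) (use assms in \<open>auto simp: coeff_eq_0\<close>)

lemma poly_act_0 [simp]: "poly_act 0 c k = 0"
  by (simp add: poly_act_def)

lemma poly_act_zero_seq [simp]: "poly_act p (\<lambda>_. 0) k = 0"
  by (simp add: poly_act_def)

text \<open>Horner's rule for the shift; it makes induction over \<open>pCons\<close> available for
  all that follows.\<close>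

lemma poly_act_pCons: "poly_act (pCons a p) c k = a * c k + poly_act p c (k - 1)"
proof -
  have "poly_act (pCons a p) c k = (\<Sum>j\<le>Suc (degree p). coeff (pCons a p) j * c (k - int j))"
    by (rule poly_act_eq_sum) (simp add: degree_pCons_le)
  also have "\<dots> = a * c k + (\<Sum>j\<le>degree p. coeff p j * c (k - 1 - int j))"
    by (subst sum.atMost_Suc_shift) (simp add: algebra_simps)
  finally show ?thesis
    by (simp add: poly_act_def)
qed

lemma poly_act_1 [simp]: "poly_act 1 c k = c k"
  by (simp add: poly_act_def)

lemma poly_act_add: "poly_act (p + q) c k = poly_act p c k + poly_act q c k"
proof -
  define N where "N = max (degree p) (degree q)"
  have "degree (p + q) \<le> N" "degree p \<le> N" "degree q \<le> N"
    by (auto simp: N_def degree_add_le_max)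
  then show ?thesis
    by (simp add: poly_act_eq_sum[of _ N] sum.distrib algebra_simps)
qed

lemma poly_act_smult: "poly_act (Polynomial.smult a p) c k = a * poly_act p c k"
  unfolding poly_act_eq_sum[OF degree_smult_le, of a p]
  by (simp add: poly_act_def sum_distrib_left mult.assoc)

lemma poly_act_diff: "poly_act (p - q) c k = poly_act p c k - poly_act q c k"
  using poly_act_add[of p "Polynomial.smult (-1) q" c k] poly_act_smult[of "-1" q c k] by simp

lemma poly_act_seq_add: "poly_act p (\<lambda>k. c k + d k) k = poly_act p c k + poly_act p d k"
  by (simp add: poly_act_def algebra_simps sum.distrib)

lemma poly_act_mult: "poly_act (p * q) c k = poly_act p (poly_act q c) k"
  by (induction p arbitrary: k)
    (simp_all add: poly_act_pCons poly_act_add poly_act_smult)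

lemma poly_act_commute: "poly_act p (poly_act q c) k = poly_act q (poly_act p c) k"
  by (simp flip: poly_act_mult add: mult.commute)

text \<open>Serves to recover \<open>b\<close> from \<open>poly_act b c\<close>: once
  \<open>p\<close> turns \<open>c\<close> into the unit sequence, applying \<open>p\<close> to
  \<open>poly_act b c\<close> leaves the coefficients of \<open>b\<close>.\<close>

lemma poly_act_delta:
  "poly_act p (\<lambda>k. if k = 0 then 1 else 0) k = (if k < 0 then 0 else coeff p (nat k))"
proof (induction p arbitrary: k)
  case (pCons a p)
  consider "k < 0" | "k = 0" | j where "k = int (Suc j)"
    by (metis linorder_neqE_linordered_idom pos_int_cases gr0_conv_Suc)
  then show ?case
    by cases (simp_all add: poly_act_pCons pCons.IH nat_add_distrib)
qed auto

lemma poly_act_monom_mult: "poly_act (monom 1 m * p) c k = poly_act p c (k - int m)"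
proof (induction m arbitrary: k)
  case (Suc m)
  have "monom 1 (Suc m) * p = pCons 0 (monom 1 m * p)"
    by (simp add: monom_Suc)
  then show ?case
    by (simp add: poly_act_pCons Suc.IH diff_diff_eq)
qed simp

lemma bounded_poly_act:
  fixes c :: "int \<Rightarrow> 'a :: {real_normed_algebra_1, comm_ring_1}"
  assumes "bounded (range c)"
  shows "bounded (range (poly_act p c))"
proof -
  obtain B where B: "\<And>k. norm (c k) \<le> B"
    using assms by (auto simp: bounded_iff)
  have "norm (poly_act p c k) \<le> (\<Sum>j\<le>degree p. norm (coeff p j) * B)" for k
    unfolding poly_act_def
    by (intro sum_norm_le order_trans[OF norm_mult_ineq] mult_left_mono B norm_ge_zero)
  then show ?thesis
    by (auto simp: bounded_iff)
qed

section \<open>Bounded sequences annihilated on a half-line\<close>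

lemma eq_0_if_norm_le_power_mult:
  fixes a :: "'a :: real_normed_vector"
  assumes "\<And>j. norm a \<le> x ^ j * B" "0 \<le> x" "x < 1"
  shows "a = 0"
proof -
  have "(\<lambda>j. x ^ j * B) \<longlonglongrightarrow> 0 * B"
    by (intro tendsto_mult LIMSEQ_power_zero tendsto_const) (use assms in auto)
  then have "norm a \<le> 0 * B"
    by (rule LIMSEQ_le_const) (use assms(1) in auto)
  then show ?thesis
    by simp
qed

lemma complex_poly_linear_factor:
  fixes q :: "complex poly"
  assumes "degree q = Suc d"
  obtains a q' where "q = q' * [:-a, 1:]" "degree q' = d"
proof -
  obtain a where "poly q a = 0"
    using alg_closed_imp_poly_has_root[of q] assms by auto
  then obtain q' where q': "q = q' * [:-a, 1:]"
    by (metis poly_eq_0_iff_dvd dvd_def mult.commute)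
  moreover have "q' \<noteq> 0"
    using assms q' by auto
  then have "degree q = Suc (degree q')"
    unfolding q' by (subst degree_mult_eq) auto
  ultimately show ?thesis
    using that assms by simp
qed

text \<open>Induction over linear factors. With the factor for a root \<open>a\<close> split off,
  the induction hypothesis gives \<open>g (k - 1) = a * g k\<close>, hence
  \<open>g k = a ^ j * g (k + int j)\<close>, which tends to 0 because \<open>g\<close> is bounded
  and \<open>norm a < 1\<close>. Each factor extends the zero range by one index to the
  left.\<close>

lemma poly_act_vanish_right:
  fixes q :: "complex poly"
  assumes "\<And>z. poly q z = 0 \<Longrightarrow> norm z < 1" and "bounded (range g)"
    and "\<And>k. k > n \<Longrightarrow> poly_act q g k = 0" and "k > n - int (degree q)"
  shows "g k = 0"
  using assms
proof (induction "degree q" arbitrary: q g k)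
  case 0
  then obtain a where q: "q = [:a:]"
    using degree_eq_zeroE by metis
  \<comment> \<open>The zero polynomial would have the root 1, which does not lie inside the
    circle.\<close>
  have "a \<noteq> 0"
    using "0.prems"(1)[of 1] q by auto
  then show ?case
    using "0.prems"(3)[of k] "0.prems"(4) by (simp add: q poly_act_pCons)
next
  case (Suc d)
  obtain a q' where q: "q = q' * [:-a, 1:]" and d: "degree q' = d"
    using complex_poly_linear_factor Suc.hyps(2) by metis
  have "norm a < 1"
    by (rule Suc.prems(1)) (simp add: q)
  obtain B where B: "\<And>k. norm (g k) \<le> B"
    using Suc.prems(2) by (auto simp: bounded_iff)
  have step: "g (k - 1) = a * g k" if "k > n - int d" for k
  proof -
    have "poly_act [:-a, 1:] g k = 0"
    proof (rule Suc.hyps(1)[of q'])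
      show "norm z < 1" if "poly q' z = 0" for z
        using that by (intro Suc.prems(1)) (simp add: q)
      show "poly_act q' (poly_act [:-a, 1:] g) l = 0" if "l > n" for l
        using Suc.prems(3)[OF that] unfolding q poly_act_mult .
    qed (use d that Suc.prems(2) in \<open>auto intro: bounded_poly_act\<close>)
    then show ?thesis
      by (simp add: poly_act_pCons)
  qed
  \<comment> \<open>Since \<open>degree q = Suc d\<close>, the index \<open>k + int (Suc j)\<close>
    exceeds \<open>n - int d\<close> already for \<open>j = 0\<close>, although \<open>k\<close>
    itself may equal \<open>n - int d\<close>. This is where one index is gained.\<close>
  have iter: "g k = a ^ j * g (k + int j)" for j
  proof (induction j)
    case (Suc j)
    have "g (k + int j) = a * g (k + int (Suc j))"
      using step[of "k + int (Suc j)"] \<open>n - int (degree q) < k\<close> \<open>Suc d = degree q\<close>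
      by simp
    then show ?case
      using Suc by simp
  qed simp
  show ?case
  proof (rule eq_0_if_norm_le_power_mult)
    show "norm (g k) \<le> norm a ^ j * B" for j
      by (subst iter[of j]) (simp add: norm_mult norm_power B mult_left_mono)
  qed (use \<open>norm a < 1\<close> in auto)
qed

text \<open>The same recurrence is now followed to the left:
  \<open>g (k - int j) = a ^ j * g k\<close> with \<open>norm a > 1\<close> is bounded only if
  \<open>g k = 0\<close>. The bound \<open>n\<close> stays fixed, since the action at
  \<open>k\<close> involves only indices up to \<open>k\<close>.\<close>

lemma poly_act_vanish_left:
  fixes q :: "complex poly"
  assumes "\<And>z. poly q z = 0 \<Longrightarrow> norm z > 1" and "bounded (range g)"
    and "\<And>k. k < n \<Longrightarrow> poly_act q g k = 0" and "k < n"
  shows "g k = 0"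
  using assms
proof (induction "degree q" arbitrary: q g k)
  case 0
  then obtain a where q: "q = [:a:]"
    using degree_eq_zeroE by metis
  have "a \<noteq> 0"
    using "0.prems"(1)[of 1] q by auto
  then show ?case
    using "0.prems"(3)[of k] "0.prems"(4) by (simp add: q poly_act_pCons)
next
  case (Suc d)
  obtain a q' where q: "q = q' * [:-a, 1:]" and d: "degree q' = d"
    using complex_poly_linear_factor Suc.hyps(2) by metis
  have "norm a > 1"
    by (rule Suc.prems(1)) (simp add: q)
  obtain B where B: "\<And>k. norm (g k) \<le> B"
    using Suc.prems(2) by (auto simp: bounded_iff)
  have step: "g (k - 1) = a * g k" if "k < n" for k
  proof -
    have "poly_act [:-a, 1:] g k = 0"
    proof (rule Suc.hyps(1)[of q'])
      show "norm z > 1" if "poly q' z = 0" for z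
        using that by (intro Suc.prems(1)) (simp add: q)
      show "poly_act q' (poly_act [:-a, 1:] g) l = 0" if "l < n" for l
        using Suc.prems(3)[OF that] unfolding q poly_act_mult .
    qed (use d that Suc.prems(2) in \<open>auto intro: bounded_poly_act\<close>)
    then show ?thesis
      by (simp add: poly_act_pCons)
  qed
  have iter: "g (k - int j) = a ^ j * g k" for j
  proof (induction j)
    case (Suc j)
    have "g (k - int j - 1) = a * g (k - int j)"
      using step[of "k - int j"] \<open>k < n\<close> by simp
    then show ?case
      using Suc by (simp add: algebra_simps)
  qed simp
  show ?case
  proof (rule eq_0_if_norm_le_power_mult)
    show "norm (g k) \<le> (1 / norm a) ^ j * B" for j
    proof -
      have "norm a ^ j * norm (g k) \<le> B"
        using B[of "k - int j"] by (simp add: iter norm_mult norm_power)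
      moreover have "0 < norm a"
        using \<open>norm a > 1\<close> by linarith
      ultimately show ?thesis
        by (simp add: power_one_over pos_le_divide_eq mult.commute)
    qed
  qed (use \<open>norm a > 1\<close> in \<open>auto simp: divide_less_eq_1\<close>)
qed

text \<open>This kernel statement yields both invertibility and uniqueness of solutions. The gap is
  placed so that, for each half of \<open>poly_act b c\<close>, the indices left open by the
  half-line lemma are covered by the support of that half.\<close>

lemma poly_eq_0_if_poly_act_vanishes:
  fixes p\<^sub>1 p\<^sub>2 b :: "complex poly"
  assumes roots1: "\<And>z. poly p\<^sub>1 z = 0 \<Longrightarrow> norm z < 1"
    and roots2: "\<And>z. poly p\<^sub>2 z = 0 \<Longrightarrow> norm z > 1"
    and c: "bounded (range c)" "\<And>k. poly_act (p\<^sub>1 * p\<^sub>2) c k = (if k = 0 then 1 else 0)"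
    and deg: "degree b \<le> n" "degree p\<^sub>1 \<le> n" "degree p\<^sub>2 \<le> n"
    and vanish: "\<And>k. - int (degree p\<^sub>1) \<le> k \<Longrightarrow> k \<le> int n - int (degree p\<^sub>1) \<Longrightarrow> poly_act b c k = 0"
  shows "b = 0"
proof -
  define p where "p = p\<^sub>1 * p\<^sub>2"
  define d where "d = poly_act b c"
  define u where "u = (\<lambda>k. if k > int n - int (degree p\<^sub>1) then d k else 0)"
  define v where "v = (\<lambda>k. if k < - int (degree p\<^sub>1) then d k else 0)"
  have d: "bounded (range d)"
    unfolding d_def by (rule bounded_poly_act) fact
  have u: "bounded (range u)" and v: "bounded (range v)"
    by (rule bounded_subset[of "insert 0 (range d)"]; use d in \<open>auto simp: u_def v_def\<close>)+
  have "d = (\<lambda>k. u k + v k)"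
    using vanish by (fastforce simp: u_def v_def d_def)
  moreover have "poly_act p d k = (if k < 0 then 0 else coeff b (nat k))" for k
  proof -
    have "poly_act p d k = poly_act b (poly_act p c) k"
      unfolding d_def by (rule poly_act_commute)
    also have "poly_act p c = (\<lambda>k. if k = 0 then 1 else 0)"
      using c(2) by (auto simp: p_def)
    finally show ?thesis
      by (simp add: poly_act_delta)
  qed
  ultimately have sum: "poly_act p u k + poly_act p v k = (if k < 0 then 0 else coeff b (nat k))" for k
    by (simp add: poly_act_seq_add)
  have "poly_act p\<^sub>2 u k = 0" for k
  proof (cases "k > int n - int (degree p\<^sub>1)")
    case True
    have "poly_act p\<^sub>1 (poly_act p\<^sub>2 u) l = 0" if "l > int n" for l
    proof -
      \<comment> \<open>The support of \<open>v\<close> ends before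
        \<open>- int (degree p\<^sub>1)\<close>, and \<open>p\<close> extends it by at most
        \<open>degree p\<^sub>1 + degree p\<^sub>2\<close>. Hence \<open>poly_act p v\<close> ends
        before \<open>degree p\<^sub>2\<close>, which is at most \<open>n\<close>.\<close>
      have "degree p \<le> degree p\<^sub>1 + degree p\<^sub>2"
        unfolding p_def by (rule degree_mult_le)
      then have "poly_act p v l = 0"
        unfolding poly_act_def by (intro sum.neutral) (use that deg in \<open>auto simp: v_def\<close>)
      moreover have "coeff b (nat l) = 0"
        by (rule coeff_eq_0) (use that deg in linarith)
      ultimately show ?thesis
        using sum[of l] that by (simp add: p_def poly_act_mult)
    qed
    from poly_act_vanish_right[OF roots1 bounded_poly_act[OF u] this] show ?thesis
      using True by simp
  next
    case False
    then show ?thesis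
      unfolding poly_act_def by (intro sum.neutral) (auto simp: u_def)
  qed
  then have "poly_act p\<^sub>2 u = (\<lambda>_. 0)"
    by blast
  then have pu: "poly_act p u k = 0" for k
    by (simp add: p_def poly_act_mult)
  have "poly_act p\<^sub>1 v k = 0" for k
  proof (cases "k < 0")
    case True
    have "poly_act p\<^sub>2 (poly_act p\<^sub>1 v) l = 0" if "l < 0" for l
      using sum[of l] pu[of l] that by (simp add: p_def poly_act_mult poly_act_commute[of p\<^sub>2])
    from poly_act_vanish_left[OF roots2 bounded_poly_act[OF v] this] show ?thesis
      using True by simp
  next
    \<comment> \<open>For \<open>k \<ge> 0\<close> only entries of \<open>v\<close> at indices from
      \<open>- int (degree p\<^sub>1)\<close> on occur, and these are 0.\<close>
    case False
    then show ?thesis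
      unfolding poly_act_def by (intro sum.neutral) (auto simp: v_def)
  qed
  then have "poly_act p\<^sub>1 v = (\<lambda>_. 0)"
    by blast
  then have "poly_act p v k = 0" for k
    by (simp add: p_def mult.commute[of p\<^sub>1] poly_act_mult)
  then have "coeff b i = 0" for i
    using sum[of "int i"] pu by simp
  then show ?thesis
    by (simp add: poly_eq_iff)
qed

section \<open>Laurent coefficients on the unit circle\<close>

lemma contour_integral_circlepath_powi:
  "((\<lambda>z. z powi m) has_contour_integral (if m = -1 then 2 * pi * \<i> else 0)) (circlepath 0 1)"
proof (cases "m = -1")
  case True
  have "((\<lambda>z. 1 / (z - 0)) has_contour_integral (2 * pi * \<i> * 1)) (circlepath 0 1)"
    using Cauchy_integral_circlepath_simple[of "\<lambda>_. 1" 0 1 0] by simp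
  then show ?thesis
    using True by (simp add: power_int_minus divide_inverse)
next
  case False
  have "((\<lambda>z. z powi m) has_contour_integral 0) (circlepath 0 1)"
  proof (rule Cauchy_theorem_primitive)
    show "((\<lambda>z. z powi (m + 1) / of_int (m + 1)) has_field_derivative z powi m) (at z within - {0})"
      if "z \<in> - {0}" for z :: complex
      using that False by (auto intro!: derivative_eq_intros simp del: of_int_add)
  qed auto
  then show ?thesis
    using False by simp
qed

text \<open>Divide by \<open>z powi (m + 1)\<close> and integrate termwise over the unit circle:
  only the term with index \<open>m\<close> survives. Absolute summability of \<open>d\<close>, read
  off at \<open>z = 1\<close>, gives the uniform convergence that justifies this.\<close>

lemma laurent_coeff_eq_0:
  fixes d :: "int \<Rightarrow> complex"
  assumes "\<And>z. norm z = 1 \<Longrightarrow> ((\<lambda>k. d k * z powi k) has_sum 0) UNIV"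
  shows "d m = 0"
proof -
  let ?C = "circlepath 0 1" and ?F = "finite_subsets_at_top (UNIV :: int set)"
  let ?f = "\<lambda>X z. \<Sum>k\<in>X. d k * z powi (k - m - 1)"
  have "d summable_on UNIV"
    using assms[of 1] by (auto simp: summable_on_def)
  then have summable: "(\<lambda>k. norm (d k)) summable_on UNIV"
    using summable_on_iff_abs_summable_on_complex by blast
  have "uniform_limit (sphere 0 1) ?f (\<lambda>_. 0) ?F"
  proof (rule Weierstrass_m_test_general'[OF _ _ summable])
    show "norm (d k * z powi (k - m - 1)) \<le> norm (d k)" if "z \<in> sphere 0 1" for k z
      using that by (simp add: norm_mult norm_power_int)
    show "((\<lambda>k. d k * z powi (k - m - 1)) has_sum 0) UNIV" if "z \<in> sphere 0 1" for z
    proof -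
      have "z \<noteq> 0"
        using that by auto
      then show ?thesis
        using has_sum_cmult_left[OF assms[of z], of "z powi (- m - 1)"] that
        by (simp add: power_int_add power_int_diff power_int_minus field_simps)
    qed
  qed
  moreover have integral: "(?f X has_contour_integral (\<Sum>k\<in>X. d k * (if k - m - 1 = -1 then 2 * pi * \<i> else 0))) ?C"
    if "finite X" for X
    by (intro has_contour_integral_sum has_contour_integral_lmul contour_integral_circlepath_powi that)
  ultimately have lim: "((\<lambda>X. contour_integral ?C (?f X)) \<longlongrightarrow> contour_integral ?C (\<lambda>_. 0)) ?F"
    by (intro contour_integral_uniform_limit_circlepath)
      (auto intro!: eventually_finite_subsets_at_top_weakI has_contour_integral_integrable)
  have "contour_integral ?C (?f X) = d m * (2 * pi * \<i>)" if "finite X" "{m} \<subseteq> X" for X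
  proof -
    have "contour_integral ?C (?f X) = (\<Sum>k\<in>X. if k = m then d k * (2 * pi * \<i>) else 0)"
      by (subst contour_integral_unique[OF integral[OF that(1)]], intro sum.cong) auto
    also have "\<dots> = d m * (2 * pi * \<i>)"
      using that by (subst sum.delta) auto
    finally show ?thesis .
  qed
  then have "\<forall>\<^sub>F X in ?F. contour_integral ?C (?f X) = d m * (2 * pi * \<i>)"
    unfolding eventually_finite_subsets_at_top by (intro exI[of _ "{m}"]) auto
  then have "((\<lambda>X. contour_integral ?C (?f X)) \<longlongrightarrow> d m * (2 * pi * \<i>)) ?F"
    by (rule tendsto_eventually)
  from tendsto_unique[OF _ this lim] show ?thesis
    by simp
qed

text \<open>By Horner's rule it suffices to treat multiplication by \<open>z\<close>, which is an
  index shift; no product of two series is needed.\<close>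

lemma has_sum_poly_act:
  fixes c :: "int \<Rightarrow> complex"
  assumes "z \<noteq> 0" "((\<lambda>k. c k * z powi k) has_sum s) UNIV"
  shows "((\<lambda>k. poly_act p c k * z powi k) has_sum (poly p z * s)) UNIV"
proof (induction p)
  case (pCons a p)
  have "((\<lambda>k. poly_act p c (k - 1) * z powi (k - 1)) has_sum (poly p z * s)) UNIV"
    using pCons.IH
    by (subst has_sum_reindex_bij_witness[where i = "\<lambda>k. k + 1" and j = "\<lambda>k. k - 1"
          and T = UNIV and h = "\<lambda>k. poly_act p c k * z powi k"]) auto
  from has_sum_cmult_right[OF this, of z]
  have "((\<lambda>k. z * (poly_act p c (k - 1) * z powi (k - 1))) has_sum (z * (poly p z * s))) UNIV" .
  also have "(\<lambda>k. z * (poly_act p c (k - 1) * z powi (k - 1))) = (\<lambda>k. poly_act p c (k - 1) * z powi k)"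
    using assms(1) by (simp add: power_int_diff)
  finally have "((\<lambda>k. a * (c k * z powi k) + poly_act p c (k - 1) * z powi k)
      has_sum (a * s + z * (poly p z * s))) UNIV"
    by (intro has_sum_add has_sum_cmult_right assms(2))
  then show ?case
    by (simp add: poly_act_pCons algebra_simps)
qed simp

text \<open>Both sides are coefficient sequences of the constant 1 on the unit circle, so their
  difference falls under \<open>laurent_coeff_eq_0\<close>.\<close>

lemma poly_act_laurent_coeffs:
  fixes c :: "int \<Rightarrow> complex"
  assumes "\<And>z. norm z = 1 \<Longrightarrow> ((\<lambda>k. c k * z powi k) has_sum (1 / poly p z)) UNIV"
    and "\<And>z. norm z = 1 \<Longrightarrow> poly p z \<noteq> 0"
  shows "poly_act p c k = (if k = 0 then 1 else 0)"
proof -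
  let ?\<delta> = "\<lambda>k::int. if k = 0 then 1 else 0 :: complex"
  have "((\<lambda>k. (poly_act p c k - ?\<delta> k) * z powi k) has_sum 0) UNIV" if "norm z = 1" for z
  proof -
    have "z \<noteq> 0"
      using that by auto
    have "((\<lambda>k. - (?\<delta> k * z powi k)) has_sum - 1) UNIV"
      by (rule has_sum_finite_neutralI[of "{0}"]) auto
    from has_sum_add[OF has_sum_poly_act[OF \<open>z \<noteq> 0\<close> assms(1)[OF that], of p] this]
    show ?thesis
      using assms(2)[OF that] by (simp add: algebra_simps)
  qed
  from laurent_coeff_eq_0[OF this, of k] show ?thesis
    by simp
qed

lemma bounded_laurent_coeffs:
  fixes c :: "int \<Rightarrow> complex"
  assumes "((\<lambda>k. c k * 1 powi k) has_sum s) UNIV"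
  shows "bounded (range c)"
proof -
  have "c summable_on UNIV"
    using assms by (auto simp: summable_on_def)
  then have "(\<lambda>k. norm (c k)) summable_on UNIV"
    using summable_on_iff_abs_summable_on_complex by blast
  then have "norm (c k) \<le> (\<Sum>\<^sub>\<infinity>k. norm (c k))" for k
    using finite_sum_le_infsum[of "\<lambda>k. norm (c k)" UNIV "{k}"] by simp
  then show ?thesis
    by (auto simp: bounded_iff)
qed

section \<open>Toeplitz systems\<close>

text \<open>Kernel vectors are presented by functions so that their entries can be read as
  coefficients of a polynomial.\<close>

lemma invertible_mat_if_kernel_trivial:
  fixes A :: "'a :: field mat"
  assumes A: "A \<in> carrier_mat n n"
    and kernel: "\<And>x. A *\<^sub>v Matrix.vec n x = 0\<^sub>v n \<Longrightarrow> Matrix.vec n x = 0\<^sub>v n"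
  shows "invertible_mat A"
proof -
  have "Determinant.det A \<noteq> 0"
  proof
    assume "Determinant.det A = 0"
    then obtain v where "v \<in> carrier_vec n" "v \<noteq> 0\<^sub>v n" "A *\<^sub>v v = 0\<^sub>v n"
      using det_0_iff_vec_prod_zero[OF A] by blast
    moreover from this have "v = Matrix.vec n (vec_index v)"
      by auto
    ultimately show False
      using kernel by metis
  qed
  from det_non_zero_imp_unit[OF A this] obtain B
    where "B \<in> carrier_mat n n" "A * B = 1\<^sub>m n" "B * A = 1\<^sub>m n"
    unfolding Units_def by (auto simp: ring_mat_def)
  with A show ?thesis
    unfolding invertible_mat_def inverts_mat_def by (auto simp: square_mat.simps)
qed

definition vec_poly :: "nat \<Rightarrow> (nat \<Rightarrow> 'a::comm_ring_1) \<Rightarrow> 'a poly" where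
  "vec_poly N x = (\<Sum>j<N. monom (x j) j)"

lemma coeff_vec_poly: "coeff (vec_poly N x) j = (if j < N then x j else 0)"
  by (simp add: vec_poly_def coeff_sum)

lemma degree_vec_poly: "degree (vec_poly (Suc n) x) \<le> n"
  by (rule degree_le) (simp add: coeff_vec_poly)

text \<open>A row of a Toeplitz matrix computes one value of a convolution, and consecutive rows
  give consecutive indices. The bounds \<open>M\<close> and \<open>N\<close> enter through equations
  because the two systems of the theorem write them in different forms.\<close>

lemma index_toeplitz_mult_vec:
  fixes x :: "nat \<Rightarrow> complex"
  assumes "i < Suc n" "M = - int n + k" "N = int n + k"
  shows "vec_index (toeplitz_mat k c M N *\<^sub>v Matrix.vec (Suc n) x) i
    = poly_act (vec_poly (Suc n) x) c (k + int i)"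
proof -
  have "nat (N - k + 1) = Suc n" "nat (k - M + 1) = Suc n"
    using assms by auto
  then have "vec_index (toeplitz_mat k c M N *\<^sub>v Matrix.vec (Suc n) x) i
      = (\<Sum>j\<in>{0..<Suc n}. c (k + int i - int j) * x j)"
    using assms(1) unfolding toeplitz_mat_def by (simp add: scalar_prod_def)
  also have "\<dots> = (\<Sum>j\<le>n. coeff (vec_poly (Suc n) x) j * c (k + int i - int j))"
    by (intro sum.cong) (auto simp: coeff_vec_poly)
  also have "\<dots> = poly_act (vec_poly (Suc n) x) c (k + int i)"
    by (rule poly_act_eq_sum[symmetric]) (rule degree_vec_poly)
  finally show ?thesis .
qed

text \<open>The power of \<open>z\<close> in the minus factor is singular only at 0, away from the
  exterior domain, and the limit at infinity is the leading coefficient of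
  \<open>p\<^sub>1\<close>.\<close>

lemma wiener_hopf_factorization_poly:
  fixes p\<^sub>1 p\<^sub>2 :: "complex poly"
  assumes roots1: "\<And>z. poly p\<^sub>1 z = 0 \<Longrightarrow> norm z < 1"
    and roots2: "\<And>z. poly p\<^sub>2 z = 0 \<Longrightarrow> norm z > 1"
    and monic: "lead_coeff p\<^sub>1 = 1"
  shows "wiener_hopf_factorization (poly (p\<^sub>1 * p\<^sub>2)) (int (degree p\<^sub>1))
    (\<lambda>z. z powi (- int (degree p\<^sub>1)) * poly p\<^sub>1 z) (poly p\<^sub>2)"
proof -
  let ?m = "\<lambda>z. z powi (- int (degree p\<^sub>1)) * poly p\<^sub>1 z"
  have "?m holomorphic_on {z. norm z > 1}"
    by (intro holomorphic_intros) auto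
  moreover have "continuous_on {z. norm z \<ge> 1} ?m"
    by (intro continuous_intros) auto
  moreover have "?m z \<noteq> 0" if "norm z \<ge> 1" for z
    using that roots1[of z] by (auto simp: power_int_eq_0_iff)
  moreover have "?m = (\<lambda>z. poly p\<^sub>1 z / z ^ degree p\<^sub>1)"
    by (simp add: power_int_minus field_simps)
  then have "(?m \<longlongrightarrow> 1) at_infinity"
    using poly_divide_tendsto_aux[of p\<^sub>1] monic by simp
  moreover have "poly p\<^sub>2 z \<noteq> 0" if "norm z \<le> 1" for z
    using that roots2[of z] by auto
  moreover have "poly (p\<^sub>1 * p\<^sub>2) z = ?m z * z powi int (degree p\<^sub>1) * poly p\<^sub>2 z" if "norm z = 1" for z
  proof -
    have "z \<noteq> 0"
      using that by auto
    then show ?thesis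
      by (simp add: power_int_minus field_simps)
  qed
  ultimately show ?thesis
    unfolding wiener_hopf_factorization_def
    by (auto intro!: holomorphic_intros continuous_intros)
qed

theorem theorem4p4:
  fixes p p\<^sub>1 p\<^sub>2 :: "complex poly" and c :: "int \<Rightarrow> complex"
    and r R :: real and \<nu> \<kappa> n\<^sub>0 :: nat
  assumes "degree p = \<nu>" and "\<nu> > 1" and "poly p 0 \<noteq> 0"
    and "0 < r" and "r < 1" and "1 < R"
    and "\<forall>z. r \<le> norm z \<and> norm z \<le> R \<longrightarrow> poly p z \<noteq> 0"
    and "\<kappa> = (\<Sum>z | poly p z = 0 \<and> norm z < 1. order z p)"
    and "0 < \<kappa>" and "\<kappa> < \<nu>"
    and "n\<^sub>0 = max \<kappa> (\<nu> - \<kappa>)"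
    and "p = p\<^sub>1 * p\<^sub>2"
    and "lead_coeff p\<^sub>1 = 1" and "degree p\<^sub>1 = \<kappa>" and "\<forall>z. poly p\<^sub>1 z = 0 \<longrightarrow> norm z < r"
    and "degree p\<^sub>2 = \<nu> - \<kappa>" and "\<forall>z. poly p\<^sub>2 z = 0 \<longrightarrow> norm z > R"
    and "laurent_expansion_on (\<lambda>z. 1 / poly p z) c {z. r \<le> norm z \<and> norm z \<le> R}"
  shows
    "(\<forall>n\<ge>n\<^sub>0. invertible_mat (toeplitz_mat (- int \<kappa>) c (- int n - int \<kappa>) (int n - int \<kappa>))) \<and>
     (\<forall>n\<ge>n\<^sub>0 + 1. \<forall>\<alpha> \<beta> :: nat \<Rightarrow> complex.
        toeplitz_mat (- int \<kappa>) c (- int n - int \<kappa> + 1) (int n - int \<kappa> - 1)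
            *\<^sub>v Matrix.vec n (\<lambda>j. \<alpha> (j + 1))
          = - Matrix.vec n (\<lambda>i. c (- int n - int \<kappa> + int i)) \<and>
        toeplitz_mat (- int \<kappa>) c (- int n - int \<kappa>) (int n - int \<kappa>)
            *\<^sub>v Matrix.vec (n + 1) \<beta>
          = unit_vec (n + 1) 0
        \<longrightarrow>
        (\<forall>j\<in>{1..n - \<kappa>}. \<alpha> j = 0) \<and> \<beta> 0 \<noteq> 0 \<and> (\<forall>j\<in>{\<nu> - \<kappa> + 1..n}. \<beta> j = 0) \<and>
        (let p\<^sub>m = (\<lambda>z. z powi (- int \<kappa>) * ((\<Sum>j=1..\<kappa>. \<alpha> (n - \<kappa> + j) * z ^ (j - 1)) + z ^ \<kappa>));
             p\<^sub>p = (\<lambda>z. \<Sum>j=0..\<nu> - \<kappa>. \<beta> j * z ^ j)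
         in wiener_hopf_factorization (poly p) (int \<kappa>) p\<^sub>m p\<^sub>p \<and>
            (\<forall>z. z \<noteq> 0 \<longrightarrow> z powi (- int \<kappa>) * poly p\<^sub>1 z = p\<^sub>m z) \<and>
            (\<forall>z. poly p\<^sub>2 z = p\<^sub>p z)))"
proof -

  \<comment> \<open>The coefficients of 1/p and the two factors\<close>
  have roots1: "norm z < 1" if "poly p\<^sub>1 z = 0" for z
    using assms(15) that \<open>r < 1\<close> by fastforce
  have roots2: "norm z > 1" if "poly p\<^sub>2 z = 0" for z
    using assms(17) that \<open>1 < R\<close> by fastforce
  have deg1: "degree p\<^sub>1 = \<kappa>" and deg2: "degree p\<^sub>2 = \<nu> - \<kappa>" and monic: "coeff p\<^sub>1 \<kappa> = 1"
    using assms by auto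
  have laurent: "((\<lambda>k. c k * z powi k) has_sum (1 / poly p z)) UNIV" and "poly p z \<noteq> 0"
    if "norm z = 1" for z
    using assms(5-7,18) that by (auto simp: laurent_expansion_on_def)
  then have pc: "poly_act (p\<^sub>1 * p\<^sub>2) c k = (if k = 0 then 1 else 0)" for k
    using poly_act_laurent_coeffs[of c p] \<open>p = p\<^sub>1 * p\<^sub>2\<close> by simp
  have c: "bounded (range c)"
    using bounded_laurent_coeffs[OF laurent[of 1]] by simp
  \<comment> \<open>Row \<open>i\<close> of either system is the index
    \<open>- int \<kappa> + int i\<close>. Solutions are identified below by applying this to a
    difference of polynomials.\<close>
  have eq0: "b = 0" if "n \<ge> n\<^sub>0" "degree b \<le> n"
    "\<And>i. i < Suc n \<Longrightarrow> poly_act b c (- int \<kappa> + int i) = 0" for b n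
  proof (rule poly_eq_0_if_poly_act_vanishes[OF roots1 roots2 c pc \<open>degree b \<le> n\<close>])
    show "poly_act b c k = 0" if "- int (degree p\<^sub>1) \<le> k" "k \<le> int n - int (degree p\<^sub>1)" for k
      using \<open>\<And>i. i < Suc n \<Longrightarrow> poly_act b c (- int \<kappa> + int i) = 0\<close>[of "nat (k + int \<kappa>)"] that
      by (simp add: deg1 nat_less_iff)
  qed (use \<open>n \<ge> n\<^sub>0\<close> assms(11) deg1 deg2 in auto)
  \<comment> \<open>This sequence expands \<open>1 / p\<^sub>2\<close>, which is analytic in the
    disc and so has no negative powers.\<close>
  have p1c: "poly_act p\<^sub>1 c k = 0" if "k < 0" for k
  proof (rule poly_act_vanish_left[OF roots2 bounded_poly_act[OF c]])
    show "poly_act p\<^sub>2 (poly_act p\<^sub>1 c) l = 0" if "l < 0" for l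
      using pc[of l] that by (simp add: poly_act_mult poly_act_commute[of p\<^sub>2])
  qed (use that in auto)
  \<comment> \<open>This sequence expands \<open>1 / p\<^sub>1\<close>, which behaves like
    \<open>z powi (- int \<kappa>)\<close> at infinity because \<open>p\<^sub>1\<close> is
    monic.\<close>
  have p2c: "poly_act p\<^sub>2 c k = (if k = - int \<kappa> then 1 else 0)" if "k \<ge> - int \<kappa>" for k
  proof -
    have vanish: "poly_act p\<^sub>2 c k = 0" if "k > - int \<kappa>" for k
    proof (rule poly_act_vanish_right[OF roots1 bounded_poly_act[OF c]])
      show "poly_act p\<^sub>1 (poly_act p\<^sub>2 c) l = 0" if "l > 0" for l
        using pc[of l] that by (simp add: poly_act_mult)
    qed (use that deg1 in auto)
    \<comment> \<open>At index 0 the indices \<open>- int j\<close> with \<open>j < \<kappa>\<close>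
      lie to the right of \<open>- int \<kappa>\<close>, so only the leading term remains and
      determines the value at \<open>- int \<kappa>\<close>.\<close>
    have "1 = (\<Sum>j\<le>\<kappa>. coeff p\<^sub>1 j * poly_act p\<^sub>2 c (- int j))"
      using pc[of 0] by (simp add: poly_act_mult poly_act_def[of p\<^sub>1] deg1)
    also have "\<dots> = (\<Sum>j\<in>{\<kappa>}. coeff p\<^sub>1 j * poly_act p\<^sub>2 c (- int j))"
      by (intro sum.mono_neutral_right) (auto simp: vanish)
    finally show ?thesis
      using that vanish[of k] monic by auto
  qed

  \<comment> \<open>Invertibility of the Toeplitz matrices\<close>
  have "invertible_mat (toeplitz_mat (- int \<kappa>) c (- int n - int \<kappa>) (int n - int \<kappa>))"
    if n: "n \<ge> n\<^sub>0" for n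
  proof (rule invertible_mat_if_kernel_trivial)
    show "toeplitz_mat (- int \<kappa>) c (- int n - int \<kappa>) (int n - int \<kappa>) \<in> carrier_mat (Suc n) (Suc n)"
      by (rule carrier_matI) (simp_all add: toeplitz_mat_def nat_add_distrib)
    fix x
    assume *: "toeplitz_mat (- int \<kappa>) c (- int n - int \<kappa>) (int n - int \<kappa>) *\<^sub>v Matrix.vec (Suc n) x
      = 0\<^sub>v (Suc n)"
    have "vec_poly (Suc n) x = 0"
    proof (rule eq0[OF n degree_vec_poly])
      show "poly_act (vec_poly (Suc n) x) c (- int \<kappa> + int i) = 0" if "i < Suc n" for i
        using that by (subst index_toeplitz_mult_vec[symmetric, OF that]) (auto simp: *)
    qed
    then have "x i = 0" if "i < Suc n" for i
      using coeff_vec_poly[of "Suc n" x i] that by simp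
    then show "Matrix.vec (Suc n) x = 0\<^sub>v (Suc n)"
      by auto
  qed

  \<comment> \<open>Solutions of the two systems\<close>
  moreover have "(\<forall>j\<in>{1..n - \<kappa>}. \<alpha> j = 0) \<and> \<beta> 0 \<noteq> 0 \<and> (\<forall>j\<in>{\<nu> - \<kappa> + 1..n}. \<beta> j = 0) \<and>
        (let p\<^sub>m = (\<lambda>z. z powi (- int \<kappa>) * ((\<Sum>j=1..\<kappa>. \<alpha> (n - \<kappa> + j) * z ^ (j - 1)) + z ^ \<kappa>));
             p\<^sub>p = (\<lambda>z. \<Sum>j=0..\<nu> - \<kappa>. \<beta> j * z ^ j)
         in wiener_hopf_factorization (poly p) (int \<kappa>) p\<^sub>m p\<^sub>p \<and>
            (\<forall>z. z \<noteq> 0 \<longrightarrow> z powi (- int \<kappa>) * poly p\<^sub>1 z = p\<^sub>m z) \<and>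
            (\<forall>z. poly p\<^sub>2 z = p\<^sub>p z))"
    if n: "n \<ge> n\<^sub>0 + 1"
      and \<alpha>: "toeplitz_mat (- int \<kappa>) c (- int n - int \<kappa> + 1) (int n - int \<kappa> - 1)
            *\<^sub>v Matrix.vec n (\<lambda>j. \<alpha> (j + 1))
          = - Matrix.vec n (\<lambda>i. c (- int n - int \<kappa> + int i))"
      and \<beta>: "toeplitz_mat (- int \<kappa>) c (- int n - int \<kappa>) (int n - int \<kappa>)
            *\<^sub>v Matrix.vec (n + 1) \<beta>
          = unit_vec (n + 1) 0"
    for n and \<alpha> \<beta> :: "nat \<Rightarrow> complex"
  proof -
    \<comment> \<open>The system for \<alpha> has size \<open>n = m + 1\<close>, so
      \<open>eq0\<close> is applied to it with \<open>m\<close>; hence the bound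
      \<open>n\<^sub>0 + 1\<close> for \<open>n\<close>.\<close>
    obtain m where m: "n = Suc m" "m \<ge> n\<^sub>0"
      using n by (cases n) auto
    have \<kappa>: "\<kappa> \<le> m" "\<nu> - \<kappa> \<le> m"
      using m assms(11) by auto

    \<comment> \<open>By \<open>p2c\<close>, the coefficients of \<open>p\<^sub>2\<close>, padded
      with zeros, solve the system for \<beta>.\<close>
    have "vec_poly (Suc n) \<beta> - p\<^sub>2 = 0"
    proof (rule eq0)
      show "degree (vec_poly (Suc n) \<beta> - p\<^sub>2) \<le> n"
        using \<kappa> m deg2 by (intro degree_diff_le degree_vec_poly) auto
      show "poly_act (vec_poly (Suc n) \<beta> - p\<^sub>2) c (- int \<kappa> + int i) = 0" if "i < Suc n" for i
      proof -
        have "poly_act (vec_poly (Suc n) \<beta>) c (- int \<kappa> + int i) = vec_index (unit_vec (n + 1) 0) i"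
          using arg_cong[OF \<beta>, of "\<lambda>v. vec_index v i"]
            index_toeplitz_mult_vec[OF that diff_conv_add_uminus diff_conv_add_uminus, of "int \<kappa>" c \<beta>]
          unfolding Suc_eq_plus1 by metis
        then show ?thesis
          using that by (simp add: poly_act_diff p2c)
      qed
    qed (use n in simp)
    then have \<beta>_coeff: "\<beta> j = coeff p\<^sub>2 j" if "j \<le> n" for j
      using coeff_vec_poly[of "Suc n" \<beta> j] that by simp

    define a where "a = vec_poly (Suc m) (\<lambda>j. \<alpha> (j + 1))"
    \<comment> \<open>Moving the right-hand side over adds the term \<open>monom 1 n\<close> to
      \<open>a\<close>. The sum must be \<open>monom 1 (n - \<kappa>) * p\<^sub>1\<close>, whose
      action in row \<open>i\<close> is that of \<open>p\<^sub>1\<close> at the negative index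
      \<open>i - n\<close>, where \<open>p1c\<close> applies.\<close>
    have "a - (monom 1 (n - \<kappa>) * p\<^sub>1 - monom 1 n) = 0"
    proof (rule eq0[OF \<open>m \<ge> n\<^sub>0\<close>])
      \<comment> \<open>The terms of degree \<open>n\<close> cancel because \<open>p\<^sub>1\<close>
        is monic, which leaves degree at most \<open>m\<close>.\<close>
      have "coeff (monom 1 (n - \<kappa>) * p\<^sub>1 - monom 1 n) i = 0" if "i > m" for i
      proof (cases "i = n")
        case True
        then show ?thesis
          using \<kappa> m monic by (simp add: coeff_monom_mult)
      next
        case False
        then show ?thesis
          using that \<kappa> m deg1 by (simp add: coeff_monom_mult coeff_eq_0)
      qed
      then show "degree (a - (monom 1 (n - \<kappa>) * p\<^sub>1 - monom 1 n)) \<le> m"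
        unfolding a_def by (intro degree_diff_le[OF degree_vec_poly] degree_le) auto
      show "poly_act (a - (monom 1 (n - \<kappa>) * p\<^sub>1 - monom 1 n)) c (- int \<kappa> + int i) = 0"
        if i: "i < Suc m" for i
      proof -
        have "poly_act a c (- int \<kappa> + int i) = vec_index (- Matrix.vec n (\<lambda>i. c (- int n - int \<kappa> + int i))) i"
        proof -
          have eqs: "- int n - int \<kappa> + 1 = - int m + - int \<kappa>" "int n - int \<kappa> - 1 = int m + - int \<kappa>"
            using m by auto
          show ?thesis
            using arg_cong[OF \<alpha>, of "\<lambda>v. vec_index v i"]
              index_toeplitz_mult_vec[OF i eqs, of c "\<lambda>j. \<alpha> (j + 1)"]
            unfolding a_def m(1)[symmetric] by metis
        qed
        also have "\<dots> = - c (- int n - int \<kappa> + int i)"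
          using i m by simp
        finally have "poly_act a c (- int \<kappa> + int i) = - c (- int n - int \<kappa> + int i)" .
        moreover have "poly_act (monom 1 (n - \<kappa>) * p\<^sub>1) c (- int \<kappa> + int i) = 0"
          using i m \<kappa> by (simp add: poly_act_monom_mult p1c)
        moreover have "poly_act (monom 1 n) c (- int \<kappa> + int i) = c (- int n - int \<kappa> + int i)"
        proof -
          have "- int \<kappa> + int i - int n = - int n - int \<kappa> + int i"
            by simp
          then show ?thesis
            using poly_act_monom_mult[of n 1 c "- int \<kappa> + int i"] by (simp only: mult_1_right poly_act_1)
        qed
        ultimately show ?thesis
          by (simp add: poly_act_diff)
      qed
    qed
    then have a_coeff: "coeff a i = coeff (monom 1 (n - \<kappa>) * p\<^sub>1 - monom 1 n) i" for i
      by simp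
    \<comment> \<open>The unknowns \<alpha> are numbered from 1, so \<open>\<alpha> (Suc i)\<close>
      belongs to the power \<open>i\<close>.\<close>
    have \<alpha>_coeff: "\<alpha> (Suc i) = (if i < n - \<kappa> then 0 else coeff p\<^sub>1 (i - (n - \<kappa>)))" if "i < n" for i
      using a_coeff[of i] that m by (auto simp: a_def coeff_vec_poly coeff_monom_mult)

    have p\<^sub>1_eq: "(\<Sum>j=1..\<kappa>. \<alpha> (n - \<kappa> + j) * z ^ (j - 1)) + z ^ \<kappa> = poly p\<^sub>1 z" for z
    proof -
      have "(\<Sum>j=1..\<kappa>. \<alpha> (n - \<kappa> + j) * z ^ (j - 1)) = (\<Sum>j<\<kappa>. coeff p\<^sub>1 j * z ^ j)"
        unfolding One_nat_def sum.atLeast1_atMost_eq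
        using \<kappa> m \<alpha>_coeff[of "n - \<kappa> + _"] by (intro sum.cong) auto
      then show ?thesis
        using monic by (simp add: poly_altdef deg1 flip: lessThan_Suc_atMost)
    qed
    have p\<^sub>2_eq: "(\<Sum>j=0..\<nu> - \<kappa>. \<beta> j * z ^ j) = poly p\<^sub>2 z" for z
      unfolding poly_altdef deg2 using \<kappa> m by (intro sum.cong) (auto simp: \<beta>_coeff)

    have "\<forall>j\<in>{1..n - \<kappa>}. \<alpha> j = 0"
    proof
      fix j
      assume "j \<in> {1..n - \<kappa>}"
      then show "\<alpha> j = 0"
        using \<alpha>_coeff[of "j - 1"] by auto
    qed
    \<comment> \<open>This is the value of \<open>p\<^sub>2\<close> at 0, a factor of the nonzero
      value of \<open>p\<close> there.\<close>
    moreover have "\<beta> 0 \<noteq> 0"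
      using assms(3,12) by (simp add: \<beta>_coeff poly_0_coeff_0[symmetric])
    moreover have "\<forall>j\<in>{\<nu> - \<kappa> + 1..n}. \<beta> j = 0"
      by (auto simp: \<beta>_coeff deg2 intro!: coeff_eq_0)
    moreover have "wiener_hopf_factorization (poly p) (int \<kappa>) (\<lambda>z. z powi (- int \<kappa>) * poly p\<^sub>1 z) (poly p\<^sub>2)"
      using wiener_hopf_factorization_poly[of p\<^sub>1 p\<^sub>2] roots1 roots2 monic deg1 assms(12) by simp
    ultimately show ?thesis
      unfolding p\<^sub>1_eq p\<^sub>2_eq Let_def by simp
  qed
  ultimately show ?thesis
    by blast
qed

end
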